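(* Let $0<\alpha\le 1$ and let $\{\mathcal{N}^{\alpha}_{c}(t)\}_{t\ge 0}$ be the convoluted fractional Poisson process with intensity parameters $\{\lambda_j\}_{j\in\mathbb{Z}}$. Let $\{N^{\alpha}(t)\}_{t\ge 0}$ be the time fractional Poisson process with intensity parameter $\lambda_0>0$, and let $\{X_i\}_{i\ge 1}$ be a sequence of independent and identically distributed random variables, independent of $\{N^{\alpha}(t)\}_{t\ge 0}$, with $$\Pr\{X_i=j\}=\frac{\lambda_{j-1}-\lambda_j}{\lambda_0},\qquad j\ge 1.$$ Then for every $t\ge 0$ $$\mathcal{N}^{\alpha}_{c}(t)\overset{d}{=}\sum_{i=1}^{N^{\alpha}(t)}X_i,$$ where $\overset{d}{=}$ denotes equality in distribution.
   Context: $\mathbb{N}_0$ denotes the non-negative integers. An empty sum is $0$. Intensity parameters: $\{\lambda_j\}_{j\in\mathbb{Z}}$ are real numbers with $\lambda_j=0$ for $j<0$, $\lambda_0>0$, $\lambda_j\ge 0$ for $j>0$, non-increasing for $j\ge 0$, and $\lim_{j\to\infty}\lambda_{j+1}/\lambda_j<1$ (this limit condition is regarded as satisfied if $\lambda_j=0$ for all large $j$). Fractional derivative (Dzhrbashyan–Caputo): $\partial_t^{\alpha}f(t)=\frac{1}{\Gamma(1-\alpha)}\int_0^t (t-s)^{-\alpha}f'(s)\,\mathrm{d}s$ for $0<\alpha<1$, and $\partial_t^{1}f(t)=f'(t)$. Convoluted fractional Poisson process (CFPP): an $\mathbb{N}_0$-valued stochastic process $\{\mathcal{N}^{\alpha}_{c}(t)\}_{t\ge0}$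 whose state probabilities $p^{\alpha}_{c}(n,t)=\Pr\{\mathcal{N}^{\alpha}_{c}(t)=n\}$ satisfy, for all $n\ge 0$, $$\partial_t^{\alpha}p^{\alpha}_{c}(n,t)=-\lambda_n * p^{\alpha}_{c}(n,t)+\lambda_{n-1}*p^{\alpha}_{c}(n-1,t),$$ where $\lambda_n*p^{\alpha}_{c}(n,t)=\sum_{j=-\infty}^{\infty}\lambda_j p^{\alpha}_{c}(n-j,t)$ is the discrete convolution in the space variable, with $p^{\alpha}_{c}(0,0)=1$, $p^{\alpha}_{c}(n,0)=0$ for $n\ge 1$, and $p^{\alpha}_{c}(-n,t)=0$ for $n\ge 1$, $t\ge 0$. Equivalently, $\partial_t^{\alpha}p^{\alpha}_{c}(n,t)=-\lambda_0 p^{\alpha}_{c}(n,t)+\sum_{j=1}^{n}(\lambda_{j-1}-\lambda_j)p^{\alpha}_{c}(n-j,t)$. Time fractional Poisson process (TFPP) with intensity $\lambda>0$: an $\mathbb{N}_0$-valued process $\{N^{\alpha}(t)\}_{t\ge0}$ whose state probabilities $p^{\alpha}(n,t)=\Pr\{N^{\alpha}(t)=n\}$ satisfy $\partial_t^{\alpha}p^{\alpha}(n,t)=-\lambda p^{\alpha}(n,t)+\lambda p^{\alpha}(n-1,t)$, $n\ge 0$, with $p^{\alpha}(-1,t)=0$, $p^{\alpha}(0,0)=1$ and $p^{\alpha}(n,0)=0$ for $n\ge 1$. *)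

theory Defs
  imports "HOL-Probability.Probability"
begin

text \<open>The Dzhrbashyan-Caputo derivative involves \<open>f'\<close> on the open interval \<open>(0,t)\<close> only:
  for the processes below \<open>f'\<close> is in general unbounded near \<open>0\<close>.\<close>

definition caputo_deriv :: "real \<Rightarrow> (real \<Rightarrow> real) \<Rightarrow> real \<Rightarrow> real" where
  "caputo_deriv \<alpha> f t =
     (if \<alpha> = 1 then deriv f t
      else 1 / Gamma (1 - \<alpha>) * (LBINT s:{0<..<t}. (t - s) powr (- \<alpha>) * deriv f s))"

text \<open>The functions on \<open>[0,\<infinity>)\<close> for which \<open>caputo_deriv \<alpha> f t\<close> is meaningful for all \<open>t > 0\<close>; the
  library operators \<open>deriv\<close> and \<open>LBINT\<close> are total and have unspecified or dummy values otherwise.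
  Continuity at \<open>0\<close> ties \<open>f\<close> on \<open>(0,\<infinity>)\<close> to its initial value \<open>f 0\<close>; together with the other
  conditions it makes \<open>f\<close> locally absolutely continuous when \<open>\<alpha> < 1\<close>.\<close>

definition caputo_differentiable :: "real \<Rightarrow> (real \<Rightarrow> real) \<Rightarrow> bool" where
  "caputo_differentiable \<alpha> f \<longleftrightarrow>
     continuous_on {0..} f \<and>
     (\<forall>t>0. f field_differentiable (at t)) \<and>
     (\<alpha> < 1 \<longrightarrow> (\<forall>t>0. set_integrable lborel {0<..<t} (\<lambda>s. (t - s) powr (- \<alpha>) * deriv f s)))"

text \<open>The second disjunct is the convention for intensities that vanish eventually.\<close>

definition intensity_parameters :: "(int \<Rightarrow> real) \<Rightarrow> bool" where
  "intensity_parameters lam \<longleftrightarrow>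
     (\<forall>j<0. lam j = 0) \<and> lam 0 > 0 \<and> (\<forall>j>0. lam j \<ge> 0) \<and>
     (\<forall>i j. 0 \<le> i \<and> i \<le> j \<longrightarrow> lam j \<le> lam i) \<and>
     ((\<exists>L<1. (\<lambda>j::nat. lam (int j + 1) / lam (int j)) \<longlonglongrightarrow> L) \<or>
      (\<forall>\<^sub>F j::nat in sequentially. lam (int j) = 0))"

definition nat_process :: "'a measure \<Rightarrow> (real \<Rightarrow> 'a \<Rightarrow> nat) \<Rightarrow> bool" where
  "nat_process M N \<longleftrightarrow> prob_space M \<and> (\<forall>t\<ge>0. N t \<in> measurable M (count_space UNIV))"

text \<open>States range over the integers so that the convolution can be written as in the
  definition of the process.\<close>

definition state_prob :: "'a measure \<Rightarrow> (real \<Rightarrow> 'a \<Rightarrow> nat) \<Rightarrow> int \<Rightarrow> real \<Rightarrow> real" where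
  "state_prob M N n t = measure M {\<omega> \<in> space M. int (N t \<omega>) = n}"

lemma state_prob_neg: "n < 0 \<Longrightarrow> state_prob M N n t = 0"
proof -
  assume "n < 0"
  hence "{\<omega> \<in> space M. int (N t \<omega>) = n} = {}" by auto
  thus ?thesis unfolding state_prob_def by (simp only: measure_empty)
qed

definition discrete_conv :: "(int \<Rightarrow> real) \<Rightarrow> (int \<Rightarrow> real) \<Rightarrow> int \<Rightarrow> real" where
  "discrete_conv a b n = (\<Sum>\<^sub>\<infinity>j\<in>UNIV. a j * b (n - j))"

text \<open>The governing equations are required for \<open>t > 0\<close>: for \<open>\<alpha> < 1\<close> the Caputo integral at \<open>t = 0\<close>
  is over the empty interval and they would fail there.\<close>

definition convoluted_fractional_poisson ::
    "real \<Rightarrow> (int \<Rightarrow> real) \<Rightarrow> 'a measure \<Rightarrow> (real \<Rightarrow> 'a \<Rightarrow> nat) \<Rightarrow> bool" where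
  "convoluted_fractional_poisson \<alpha> lam M N \<longleftrightarrow>
     nat_process M N \<and>
     state_prob M N 0 0 = 1 \<and>
     (\<forall>n\<ge>1. state_prob M N n 0 = 0) \<and>
     (\<forall>n\<ge>0. caputo_differentiable \<alpha> (state_prob M N n) \<and>
        (\<forall>t>0. caputo_deriv \<alpha> (state_prob M N n) t =
           - discrete_conv lam (\<lambda>k. state_prob M N k t) n
           + discrete_conv lam (\<lambda>k. state_prob M N k t) (n - 1)))"

definition time_fractional_poisson ::
    "real \<Rightarrow> real \<Rightarrow> 'a measure \<Rightarrow> (real \<Rightarrow> 'a \<Rightarrow> nat) \<Rightarrow> bool" where
  "time_fractional_poisson \<alpha> l M N \<longleftrightarrow>
     nat_process M N \<and>
     state_prob M N 0 0 = 1 \<and>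
     (\<forall>n\<ge>1. state_prob M N n 0 = 0) \<and>
     (\<forall>n\<ge>0. caputo_differentiable \<alpha> (state_prob M N n) \<and>
        (\<forall>t>0. caputo_deriv \<alpha> (state_prob M N n) t =
           - l * state_prob M N n t + l * state_prob M N (n - 1) t))"

text \<open>Independence of two families of natural-valued random variables, each taken as a whole:
  the \<open>\<sigma>\<close>-algebras they generate are independent. The library's \<open>indep_var\<close> does not apply, since it
  needs both random elements to have the same type and the index types differ here.\<close>

definition generated_sets ::
    "'a measure \<Rightarrow> 'i set \<Rightarrow> ('i \<Rightarrow> 'a \<Rightarrow> nat) \<Rightarrow> 'a set set" where
  "generated_sets M I X =
     sets (vimage_algebra (space M) (\<lambda>\<omega>. \<lambda>i\<in>I. X i \<omega>) (Pi\<^sub>M I (\<lambda>_. count_space UNIV)))"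

definition indep_families ::
    "'a measure \<Rightarrow> 'i set \<Rightarrow> ('i \<Rightarrow> 'a \<Rightarrow> nat) \<Rightarrow> 'j set \<Rightarrow> ('j \<Rightarrow> 'a \<Rightarrow> nat) \<Rightarrow> bool" where
  "indep_families M I X J Y \<longleftrightarrow>
     prob_space.indep_set M (generated_sets M I X) (generated_sets M J Y)"

end

theory Submission
  imports Defs
begin

text \<open>
  Conditioning on \<open>N(t)\<close> turns the law of the random sum into
  \<open>q(n,t) = \<Sum>k\<le>n. a\<^sup>*\<^sup>k(n) p(k,t)\<close>, where \<open>a\<^sup>*\<^sup>k\<close> is the law of \<open>X\<^sub>1 + \<dots> + X\<^sub>k\<close>; the sum is
  finite because \<open>\<lambda>\<^sub>j \<rightarrow> 0\<close> forces \<open>X\<^sub>i \<ge> 1\<close> almost surely. By linearity of the Caputo derivative \<open>q\<close>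
  solves the governing equations of the convoluted process. By induction on \<open>n\<close>, the difference
  \<open>f\<close> of two solutions satisfies \<open>\<partial>\<^sup>\<alpha> f = - \<lambda>\<^sub>0 f\<close> and \<open>f 0 = 0\<close>. Such an \<open>f\<close> vanishes by a maximum
  principle: at a maximum of \<open>f\<close> on \<open>[0,t]\<close> attained at \<open>t\<close> the Caputo derivative is nonnegative, which
  rules out a positive maximum; the same applies to \<open>- f\<close>.
\<close>

section \<open>Linearity of the Caputo derivative\<close>

lemma caputo_differentiable_cmult:
  assumes "caputo_differentiable \<alpha> f"
  shows "caputo_differentiable \<alpha> (\<lambda>t. c * f t)"
proof -
  \<comment> \<open>The rule for \<open>deriv\<close> needs differentiability of \<open>f\<close>,
    known only for \<open>s > 0\<close>; the integrals over \<open>{0<..<t}\<close> see no other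
    points.\<close>
  have d: "deriv (\<lambda>t. c * f t) s = c * deriv f s" if "s > 0" for s
    using assms that by (simp add: caputo_differentiable_def)
  have "set_integrable lborel {0<..<t} (\<lambda>s. (t - s) powr (- \<alpha>) * deriv (\<lambda>t. c * f t) s)"
    if "\<alpha> < 1" "t > 0" for t
  proof -
    have "set_integrable lborel {0<..<t} (\<lambda>s. c * ((t - s) powr (- \<alpha>) * deriv f s))"
      using assms that by (auto simp: caputo_differentiable_def)
    also have "?this \<longleftrightarrow> ?thesis"
      by (rule set_integrable_cong) (auto simp: d)
    finally show ?thesis .
  qed
  with assms show ?thesis
    unfolding caputo_differentiable_def
    by (auto intro!: continuous_intros derivative_intros field_differentiable_mult)
qed

lemma caputo_deriv_cmult:
  assumes "caputo_differentiable \<alpha> f" and "t > 0"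
  shows "caputo_deriv \<alpha> (\<lambda>t. c * f t) t = c * caputo_deriv \<alpha> f t"
proof -
  have d: "deriv (\<lambda>t. c * f t) s = c * deriv f s" if "s > 0" for s
    using assms that by (simp add: caputo_differentiable_def)
  have "(LBINT s:{0<..<t}. (t - s) powr (- \<alpha>) * deriv (\<lambda>t. c * f t) s)
      = (LBINT s:{0<..<t}. c * ((t - s) powr (- \<alpha>) * deriv f s))"
    by (rule set_lebesgue_integral_cong) (auto simp: d)
  then show ?thesis
    using assms by (simp add: caputo_deriv_def d)
qed

lemma caputo_differentiable_add:
  assumes "caputo_differentiable \<alpha> f" and "caputo_differentiable \<alpha> g"
  shows "caputo_differentiable \<alpha> (\<lambda>t. f t + g t)"
proof -
  have d: "deriv (\<lambda>t. f t + g t) s = deriv f s + deriv g s" if "s > 0" for s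
    using assms that by (simp add: caputo_differentiable_def)
  have "set_integrable lborel {0<..<t} (\<lambda>s. (t - s) powr (- \<alpha>) * deriv (\<lambda>t. f t + g t) s)"
    if "\<alpha> < 1" "t > 0" for t
  proof -
    have "set_integrable lborel {0<..<t}
        (\<lambda>s. (t - s) powr (- \<alpha>) * deriv f s + (t - s) powr (- \<alpha>) * deriv g s)"
      using assms that by (auto simp: caputo_differentiable_def)
    also have "?this \<longleftrightarrow> ?thesis"
      by (rule set_integrable_cong) (auto simp: d algebra_simps)
    finally show ?thesis .
  qed
  with assms show ?thesis
    unfolding caputo_differentiable_def
    by (auto intro!: continuous_intros field_differentiable_add)
qed

text \<open>Splitting the integral of a sum requires both integrands to be integrable, which
  \<open>caputo_differentiable\<close> provides only for \<alpha> < 1; hence the bound on \<alpha>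
  and the case split. Pulling out a constant factor needs neither.\<close>

lemma caputo_deriv_add:
  assumes "caputo_differentiable \<alpha> f" and "caputo_differentiable \<alpha> g"
    and "\<alpha> \<le> 1" and "t > 0"
  shows "caputo_deriv \<alpha> (\<lambda>t. f t + g t) t = caputo_deriv \<alpha> f t + caputo_deriv \<alpha> g t"
proof (cases "\<alpha> = 1")
  case True
  then show ?thesis
    using assms by (simp add: caputo_deriv_def caputo_differentiable_def)
next
  case False
  have d: "deriv (\<lambda>t. f t + g t) s = deriv f s + deriv g s" if "s > 0" for s
    using assms that by (simp add: caputo_differentiable_def)
  have "(LBINT s:{0<..<t}. (t - s) powr (- \<alpha>) * deriv (\<lambda>t. f t + g t) s)
      = (LBINT s:{0<..<t}. (t - s) powr (- \<alpha>) * deriv f s + (t - s) powr (- \<alpha>) * deriv g s)"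
    by (rule set_lebesgue_integral_cong) (auto simp: d algebra_simps)
  also have "\<dots> = (LBINT s:{0<..<t}. (t - s) powr (- \<alpha>) * deriv f s)
      + (LBINT s:{0<..<t}. (t - s) powr (- \<alpha>) * deriv g s)"
    using assms False by (intro set_integral_add) (auto simp: caputo_differentiable_def)
  finally show ?thesis
    using False by (simp add: caputo_deriv_def algebra_simps add_divide_distrib)
qed

lemma caputo_sum:
  assumes "finite K" and "\<And>k. k \<in> K \<Longrightarrow> caputo_differentiable \<alpha> (f k)" and "\<alpha> \<le> 1"
  shows "caputo_differentiable \<alpha> (\<lambda>t. \<Sum>k\<in>K. f k t)"
    and "t > 0 \<Longrightarrow> caputo_deriv \<alpha> (\<lambda>t. \<Sum>k\<in>K. f k t) t = (\<Sum>k\<in>K. caputo_deriv \<alpha> (f k) t)"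
proof -
  have "caputo_differentiable \<alpha> (\<lambda>t. \<Sum>k\<in>K. f k t) \<and>
    (t > 0 \<longrightarrow> caputo_deriv \<alpha> (\<lambda>t. \<Sum>k\<in>K. f k t) t = (\<Sum>k\<in>K. caputo_deriv \<alpha> (f k) t))"
    using assms(1,2)
  proof (induction K rule: finite_induct)
    case empty
    then show ?case by (simp add: caputo_differentiable_def caputo_deriv_def set_integrable_def)
  next
    case (insert k K)
    then show ?case
      using assms(3) by (simp add: caputo_differentiable_add caputo_deriv_add)
  qed
  then show "caputo_differentiable \<alpha> (\<lambda>t. \<Sum>k\<in>K. f k t)"
    and "t > 0 \<Longrightarrow> caputo_deriv \<alpha> (\<lambda>t. \<Sum>k\<in>K. f k t) t = (\<Sum>k\<in>K. caputo_deriv \<alpha> (f k) t)"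
    by auto
qed

section \<open>Maximum principle and uniqueness for the relaxation equation\<close>

text \<open>For \<open>\<alpha> < 1\<close> the idea is to compare \<open>- (t - s)\<^sup>-\<^sup>\<alpha> f'(s)\<close> with the derivative of
  \<open>h(s) = (t - s)\<^sup>-\<^sup>\<alpha> (f(t) - f(s))\<close>, which exceeds it by a nonnegative term and integrates to
  \<open>- h(0) \<le> 0\<close>. Continuity of \<open>h\<close> at \<open>t\<close>, where \<open>0 powr (- \<alpha>) = 0\<close>, uses differentiability of \<open>f\<close> at \<open>t\<close>.\<close>

lemma caputo_deriv_nonneg_at_max:
  assumes f: "caputo_differentiable \<alpha> f" and \<alpha>: "0 < \<alpha>" "\<alpha> \<le> 1" and t: "t > 0"
    and max: "\<And>s. 0 \<le> s \<Longrightarrow> s \<le> t \<Longrightarrow> f s \<le> f t"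
  shows "caputo_deriv \<alpha> f t \<ge> 0"
proof (cases "\<alpha> = 1")
  case True
  have D: "(f has_real_derivative deriv f t) (at t)"
    using f t by (simp add: caputo_differentiable_def field_differentiable_derivI)
  show ?thesis
  proof (rule ccontr)
    assume "\<not> ?thesis"
    then have "deriv f t < 0" using True by (simp add: caputo_deriv_def)
    from DERIV_neg_dec_left[OF D this] obtain d
      where "d > 0" and d: "\<And>h. 0 < h \<Longrightarrow> h < d \<Longrightarrow> f t < f (t - h)" by blast
    \<comment> \<open>The cap by \<open>t\<close> keeps \<open>t - h\<close> nonnegative, so that
      maximality applies there.\<close>
    define h where "h = min (d / 2) t"
    have "0 < h" "h < d" "h \<le> t" using \<open>d > 0\<close> t by (auto simp: h_def)
    then show False using d[of h] max[of "t - h"] by auto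
  qed
next
  case False
  then have \<alpha>1: "\<alpha> < 1" using \<alpha> by simp
  have Df: "(f has_real_derivative deriv f s) (at s)" if "s > 0" for s
    using f that by (simp add: caputo_differentiable_def field_differentiable_derivI)
  have cf: "continuous_on {0..} f" using f by (simp add: caputo_differentiable_def)
  define h where "h s = (t - s) powr (- \<alpha>) * (f t - f s)" for s
  define h' where "h' s = \<alpha> * (t - s) powr (- \<alpha> - 1) * (f t - f s)
      - (t - s) powr (- \<alpha>) * deriv f s" for s
  define F where "F s = (t - s) powr (- \<alpha>) * deriv f s" for s
  have Dh: "(h has_real_derivative h' s) (at s)" if "s \<in> {0<..<t}" for s
    unfolding h_def h'_def using that
    by (auto intro!: derivative_eq_intros Df
        simp: algebra_simps powr_diff diff_divide_distrib)
  \<comment> \<open>Near \<open>t\<close>, \<open>h s\<close> is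
    \<open>(t - s) powr (1 - \<alpha>)\<close> times a difference quotient of \<open>f\<close>: the
    first factor tends to 0 because \<alpha> < 1, the second to \<open>deriv f t\<close>.\<close>
  have ct: "(h \<longlongrightarrow> 0) (at t within {0..t})"
  proof -
    have "((\<lambda>s. (t - s) powr (1 - \<alpha>) * ((f s - f t) / (s - t))) \<longlongrightarrow> 0 * deriv f t)
        (at t within {0..t})"
    proof (rule tendsto_mult)
      show "((\<lambda>s. (t - s) powr (1 - \<alpha>)) \<longlongrightarrow> 0) (at t within {0..t})"
      proof -
        have "((\<lambda>s. (t - s) powr (1 - \<alpha>)) \<longlongrightarrow> (t - t) powr (1 - \<alpha>)) (at t within {0..t})"
          using \<alpha>1
          by (intro tendsto_powr2 tendsto_intros) (auto simp: eventually_at intro!: exI[of _ 1])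
        then show ?thesis by simp
      qed
      show "((\<lambda>s. (f s - f t) / (s - t)) \<longlongrightarrow> deriv f t) (at t within {0..t})"
        using has_field_derivative_at_within[OF Df[OF t]] by (simp add: has_field_derivative_iff)
    qed
    then have "((\<lambda>s. (t - s) powr (1 - \<alpha>) * ((f s - f t) / (s - t))) \<longlongrightarrow> 0) (at t within {0..t})"
      by simp
    moreover have "\<forall>\<^sub>F s in at t within {0..t}. (t - s) powr (1 - \<alpha>) * ((f s - f t) / (s - t)) = h s"
      unfolding eventually_at_filter
    proof (intro always_eventually allI impI)
      fix s assume "s \<noteq> t" "s \<in> {0..t}"
      then have "t - s > 0" by simp
      then have "(t - s) powr (1 - \<alpha>) = (t - s) * (t - s) powr (- \<alpha>)"
        by (simp add: powr_diff powr_minus divide_inverse)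
      moreover have "(f s - f t) / (s - t) = (f t - f s) / (t - s)"
        by (metis minus_diff_eq minus_divide_divide)
      ultimately show "(t - s) powr (1 - \<alpha>) * ((f s - f t) / (s - t)) = h s"
        using \<open>t - s > 0\<close> by (simp add: h_def)
    qed
    ultimately show ?thesis by (rule Lim_transform_eventually)
  qed
  have ch: "continuous_on {0..t} h"
    unfolding continuous_on_eq_continuous_within
  proof
    fix s assume s: "s \<in> {0..t}"
    show "continuous (at s within {0..t}) h"
    proof (cases "s = t")
      case True
      then show ?thesis using ct by (simp add: continuous_within h_def)
    next
      case False
      then have "t - s \<noteq> 0" by simp
      moreover have "continuous (at s within {0..t}) f"
        using cf s by (meson atLeast_iff atLeastAtMost_iff continuous_on_eq_continuous_within
            continuous_within_subset subsetI)
      ultimately show ?thesis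
        unfolding h_def by (intro continuous_intros) auto
    qed
  qed
  \<comment> \<open>\<open>h'\<close> may be unbounded near both ends. The gauge integral form of
    the fundamental theorem asks only for continuity of \<open>h\<close> on the closed interval and
    the derivative inside, so integrability of \<open>h'\<close> comes for free.\<close>
  have "(h' has_integral (h t - h 0)) {0..t}"
    using t ch Dh
    by (intro fundamental_theorem_of_calculus_interior)
      (auto simp flip: has_real_derivative_iff_has_vector_derivative)
  then have I1: "(h' has_integral (h t - h 0)) {0<..<t}"
    by (simp add: has_integral_Icc_iff_Ioo)
  have F: "set_integrable lborel {0<..<t} F"
    using f \<alpha>1 t unfolding F_def caputo_differentiable_def by blast
  then have I2: "(F has_integral (LBINT s:{0<..<t}. F s)) {0<..<t}"
    using set_borel_integral_eq_integral[OF F] by (simp add: has_integral_iff)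
  have "- (LBINT s:{0<..<t}. F s) \<le> h t - h 0"
  proof (rule has_integral_le[OF has_integral_neg[OF I2] I1])
    fix s assume "s \<in> {0<..<t}"
    then show "- F s \<le> h' s"
      using max[of s] \<alpha> by (simp add: F_def h'_def)
  qed
  also have "\<dots> \<le> 0" using max[of 0] t by (simp add: h_def)
  finally have "(LBINT s:{0<..<t}. F s) \<ge> 0" by simp
  then show ?thesis
    using False \<alpha>1 by (simp add: caputo_deriv_def F_def Gamma_real_nonneg)
qed

lemma caputo_relaxation_nonpos:
  assumes f: "caputo_differentiable \<alpha> f" and \<alpha>: "0 < \<alpha>" "\<alpha> \<le> 1" and "l > 0"
    and "f 0 \<le> 0" and eq: "\<And>t. t > 0 \<Longrightarrow> caputo_deriv \<alpha> f t = - l * f t"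
    and "t \<ge> 0"
  shows "f t \<le> 0"
proof (rule ccontr)
  assume "\<not> f t \<le> 0"
  have "continuous_on {0..t} f"
    using f by (auto simp: caputo_differentiable_def intro: continuous_on_subset)
  \<comment> \<open>A maximum over \<open>{0..t}\<close> attained at \<open>u\<close> is also one
    over \<open>{0..u}\<close>, which is what the maximum principle at \<open>u\<close>
    needs.\<close>
  then obtain u where u: "u \<in> {0..t}" and max: "\<And>s. s \<in> {0..t} \<Longrightarrow> f s \<le> f u"
    using continuous_attains_sup[of "{0..t}" f] \<open>t \<ge> 0\<close> by auto
  have "f u > 0" using max[of t] \<open>\<not> f t \<le> 0\<close> \<open>t \<ge> 0\<close> by simp
  with \<open>f 0 \<le> 0\<close> have "u \<noteq> 0" by auto
  then have "u > 0" using u by simp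
  then have "0 \<le> - l * f u"
    using caputo_deriv_nonneg_at_max[OF f \<alpha> \<open>u > 0\<close>] max u eq[of u] by simp
  moreover have "l * f u > 0" using \<open>f u > 0\<close> \<open>l > 0\<close> by simp
  ultimately show False by simp
qed

lemma caputo_relaxation_zero:
  assumes f: "caputo_differentiable \<alpha> f" and \<alpha>: "0 < \<alpha>" "\<alpha> \<le> 1" and "l > 0"
    and "f 0 = 0" and eq: "\<And>t. t > 0 \<Longrightarrow> caputo_deriv \<alpha> f t = - l * f t"
    and "t \<ge> 0"
  shows "f t = 0"
proof (rule antisym)
  show "f t \<le> 0"
    by (rule caputo_relaxation_nonpos[OF f \<alpha> \<open>l > 0\<close>]) (use assms in auto)
  \<comment> \<open>The negative is written as a multiple so that the scaling lemmas match.\<close>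
  have "- 1 * f t \<le> 0"
    by (rule caputo_relaxation_nonpos[OF caputo_differentiable_cmult[OF f] \<alpha> \<open>l > 0\<close>])
      (use assms caputo_deriv_cmult[OF f, of _ "-1"] in auto)
  then show "0 \<le> f t" by simp
qed

section \<open>Convolution powers of the jump law\<close>

text \<open>The law of a sum of \<open>k\<close> independent variables with values \<open>\<ge> 1\<close> and law \<open>a\<close>; the value \<open>a 0\<close> is
  ignored.\<close>

fun iter_conv :: "(nat \<Rightarrow> real) \<Rightarrow> nat \<Rightarrow> nat \<Rightarrow> real" where
  "iter_conv a 0 n = of_bool (n = 0)"
| "iter_conv a (Suc k) n = (\<Sum>j = 1..n. a j * iter_conv a k (n - j))"

text \<open>A sum of \<open>k\<close> jumps of size at least 1 is at least \<open>k\<close>. This is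
  what truncates every sum over the number of jumps at \<open>n\<close>.\<close>

lemma iter_conv_eq_0: "n < k \<Longrightarrow> iter_conv a k n = 0"
proof (induction k arbitrary: n)
  case (Suc k)
  then have "iter_conv a k (n - j) = 0" if "j \<in> {1..n}" for j
    using that by auto
  then show ?case by simp
qed simp

text \<open>Peeling one jump off each convolution power turns the shift \<open>k - 1\<close> in the
  number of jumps, as in the equation of the time fractional process, into a convolution with
  \<open>a\<close> in the space variable, as in the convoluted equation.\<close>

lemma sum_iter_conv_shift:
  "(\<Sum>k\<le>n. iter_conv a k n * (if k = 0 then 0 else p (k - 1)))
   = (\<Sum>j = 1..n. a j * (\<Sum>k\<le>n - j. iter_conv a k (n - j) * p k))"
proof (cases n)
  case (Suc m)
  have "(\<Sum>k\<le>n. iter_conv a k n * (if k = 0 then 0 else p (k - 1)))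
      = (\<Sum>k\<le>m. iter_conv a (Suc k) n * p k)"
    unfolding Suc sum.atMost_Suc_shift by simp
  also have "\<dots> = (\<Sum>j = 1..n. \<Sum>k\<le>m. a j * (iter_conv a k (n - j) * p k))"
    by (subst sum.swap) (simp add: sum_distrib_right mult.assoc)
  \<comment> \<open>The inner range shrinks from \<open>m\<close> to \<open>n - j\<close>; the
    dropped terms have more jumps than \<open>n - j\<close> allows.\<close>
  also have "\<dots> = (\<Sum>j = 1..n. a j * (\<Sum>k\<le>n - j. iter_conv a k (n - j) * p k))"
    unfolding sum_distrib_left
  proof (rule sum.cong[OF refl], rule sum.mono_neutral_right)
    fix j assume j: "j \<in> {1..n}"
    show "{..n - j} \<subseteq> {..m}" using j Suc by auto
    show "\<forall>k\<in>{..m} - {..n - j}. a j * (iter_conv a k (n - j) * p k) = 0"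
      by (auto simp: iter_conv_eq_0)
  qed simp
  finally show ?thesis .
qed simp

section \<open>Law of the random sum\<close>

context prob_space
begin

text \<open>Induction on \<open>k\<close>, splitting by the value of the last summand, which is
  independent of the sum of the others.\<close>

lemma prob_partial_sum:
  fixes X :: "nat \<Rightarrow> 'a \<Rightarrow> nat"
  assumes indep: "indep_vars (\<lambda>_. count_space UNIV) X {1..}"
    and X0: "\<And>i. i \<ge> 1 \<Longrightarrow> prob {\<omega> \<in> space M. X i \<omega> = 0} = 0"
    and Xj: "\<And>i j. i \<ge> 1 \<Longrightarrow> j \<ge> 1 \<Longrightarrow> prob {\<omega> \<in> space M. X i \<omega> = j} = a j"
  shows "prob {\<omega> \<in> space M. (\<Sum>i = 1..k. X i \<omega>) = n} = iter_conv a k n"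
proof (induction k arbitrary: n)
  case 0
  then show ?case by (cases n) (auto simp: prob_space)
next
  case (Suc k)
  have X [measurable]: "X i \<in> measurable M (count_space UNIV)" if "i \<in> {1..}" for i
    using indep that by (auto simp: indep_vars_def)
  have [measurable]: "(\<lambda>\<omega>. \<Sum>i = 1..k. X i \<omega>) \<in> measurable M (count_space UNIV)"
    by (rule measurable_sum_nat) (auto intro: X)
  have [measurable]: "X (Suc k) \<in> measurable M (count_space UNIV)" by (rule X) simp
  \<comment> \<open>The variables are moved to the reals because \<open>indep_vars_sum\<close> is
    stated for real-valued variables.\<close>
  have "indep_vars (\<lambda>_. borel) (\<lambda>i \<omega>. real (X i \<omega>)) {1..}"
    by (rule indep_vars_compose2[OF indep]) simp
  then have "indep_vars (\<lambda>_. borel) (\<lambda>i \<omega>. real (X i \<omega>)) (insert (Suc k) {1..k})"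
    by (rule indep_vars_subset) auto
  then have iv: "indep_var borel (\<lambda>\<omega>. real (X (Suc k) \<omega>)) borel (\<lambda>\<omega>. \<Sum>i = 1..k. real (X i \<omega>))"
    by (intro indep_vars_sum) auto
  \<comment> \<open>For \<open>j > n\<close> the subtraction truncates to 0 and \<open>A j\<close>
    loses its meaning; only \<open>j \<le> n\<close> enters the union below.\<close>
  define A where "A j = {\<omega> \<in> space M. X (Suc k) \<omega> = j \<and> (\<Sum>i = 1..k. X i \<omega>) = n - j}" for j
  have A: "prob (A j) = prob {\<omega> \<in> space M. X (Suc k) \<omega> = j} * iter_conv a k (n - j)" for j
  proof -
    have eq: "(\<Sum>i = 1..k. real (X i \<omega>)) = real m \<longleftrightarrow> (\<Sum>i = 1..k. X i \<omega>) = m" for m \<omega>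
      unfolding of_nat_sum[symmetric] of_nat_eq_iff ..
    have "A j = (\<lambda>\<omega>. (real (X (Suc k) \<omega>), \<Sum>i = 1..k. real (X i \<omega>)))
        -` ({real j} \<times> {real (n - j)}) \<inter> space M"
      unfolding A_def using eq by auto
    also have "prob \<dots> = prob ((\<lambda>\<omega>. real (X (Suc k) \<omega>)) -` {real j} \<inter> space M)
        * prob ((\<lambda>\<omega>. \<Sum>i = 1..k. real (X i \<omega>)) -` {real (n - j)} \<inter> space M)"
      by (rule indep_varD[OF iv]) auto
    also have "(\<lambda>\<omega>. real (X (Suc k) \<omega>)) -` {real j} \<inter> space M = {\<omega> \<in> space M. X (Suc k) \<omega> = j}"
      by auto
    also have "(\<lambda>\<omega>. \<Sum>i = 1..k. real (X i \<omega>)) -` {real (n - j)} \<inter> space M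
        = {\<omega> \<in> space M. (\<Sum>i = 1..k. X i \<omega>) = n - j}"
      using eq by auto
    finally show ?thesis by (simp only: Suc.IH)
  qed
  have [measurable]: "A j \<in> events" for j
    unfolding A_def by measurable
  have "{\<omega> \<in> space M. (\<Sum>i = 1..Suc k. X i \<omega>) = n} = (\<Union>j\<le>n. A j)"
    by (auto simp: A_def)
  also have "prob \<dots> = (\<Sum>j\<le>n. prob (A j))"
    by (rule finite_measure_finite_Union) (auto, auto simp: A_def disjoint_family_on_def)
  \<comment> \<open>The term \<open>j = 0\<close> vanishes by \<open>X0\<close>, which is why
    \<open>iter_conv\<close> may start at 1.\<close>
  also have "\<dots> = (\<Sum>j = 1..n. prob (A j))"
    by (rule sum.mono_neutral_right) (auto simp: A X0 Suc_le_eq)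
  also have "\<dots> = iter_conv a (Suc k) n"
    by (simp add: A Xj)
  finally show ?case .
qed

lemma indep_families_prob:
  fixes X :: "'i \<Rightarrow> 'a \<Rightarrow> nat" and Y :: "'j \<Rightarrow> 'a \<Rightarrow> nat"
  assumes "indep_families M I X J Y"
    and "A \<in> sets (Pi\<^sub>M I (\<lambda>_. count_space UNIV))" and "B \<in> sets (Pi\<^sub>M J (\<lambda>_. count_space UNIV))"
  shows "prob {\<omega> \<in> space M. (\<lambda>i\<in>I. X i \<omega>) \<in> A \<and> (\<lambda>j\<in>J. Y j \<omega>) \<in> B}
    = prob {\<omega> \<in> space M. (\<lambda>i\<in>I. X i \<omega>) \<in> A} * prob {\<omega> \<in> space M. (\<lambda>j\<in>J. Y j \<omega>) \<in> B}"
proof -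
  let ?A = "(\<lambda>\<omega>. \<lambda>i\<in>I. X i \<omega>) -` A \<inter> space M" and ?B = "(\<lambda>\<omega>. \<lambda>j\<in>J. Y j \<omega>) -` B \<inter> space M"
  have "prob (?A \<inter> ?B) = prob ?A * prob ?B"
    using assms unfolding indep_families_def generated_sets_def
    by (intro indep_setD) (auto intro: in_vimage_algebra)
  then show ?thesis
    by (simp add: vimage_def Int_def conj_ac cong: conj_cong)
qed

text \<open>Split by the value \<open>k\<close> of \<open>N t\<close>. For fixed \<open>k\<close>
  the two conditions concern the path of \<open>X\<close> and the path of \<open>N\<close>
  separately, so independence of the families factors the probability.\<close>

lemma prob_random_sum:
  fixes X :: "nat \<Rightarrow> 'a \<Rightarrow> nat" and N :: "real \<Rightarrow> 'a \<Rightarrow> nat"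
  assumes indep: "indep_vars (\<lambda>_. count_space UNIV) X {1..}"
    and X0: "\<And>i. i \<ge> 1 \<Longrightarrow> prob {\<omega> \<in> space M. X i \<omega> = 0} = 0"
    and Xj: "\<And>i j. i \<ge> 1 \<Longrightarrow> j \<ge> 1 \<Longrightarrow> prob {\<omega> \<in> space M. X i \<omega> = j} = a j"
    and XN: "indep_families M {1..} X T N" and t: "t \<in> T"
    and N [measurable]: "N t \<in> measurable M (count_space UNIV)"
  shows "prob {\<omega> \<in> space M. (\<Sum>i = 1..N t \<omega>. X i \<omega>) = n}
    = (\<Sum>k\<le>n. iter_conv a k n * prob {\<omega> \<in> space M. N t \<omega> = k})"
proof -
  have X: "X i \<in> measurable M (count_space UNIV)" if "i \<in> {1..}" for i
    using indep that by (auto simp: indep_vars_def)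
  have [measurable]: "(\<lambda>\<omega>. \<Sum>i = 1..k. X i \<omega>) \<in> measurable M (count_space UNIV)" for k
    by (rule measurable_sum_nat) (auto intro: X)
  define A where "A k = {\<omega> \<in> space M. (\<Sum>i = 1..k. X i \<omega>) = n \<and> N t \<omega> = k}" for k
  have A: "prob (A k) = iter_conv a k n * prob {\<omega> \<in> space M. N t \<omega> = k}" for k
  proof -
    let ?P = "Pi\<^sub>M {1..} (\<lambda>_. count_space UNIV) :: (nat \<Rightarrow> nat) measure"
    let ?Q = "Pi\<^sub>M T (\<lambda>_. count_space UNIV) :: (real \<Rightarrow> nat) measure"
    have [measurable]: "(\<lambda>x. \<Sum>i = 1..k. x i) \<in> measurable ?P (count_space UNIV)"
      by (rule measurable_sum_nat) auto
    have "{x \<in> space ?P. (\<Sum>i = 1..k. x i) = n} \<in> sets ?P" by measurable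
    moreover have [measurable]: "(\<lambda>y. y t) \<in> measurable ?Q (count_space UNIV)"
      using t by (rule measurable_component_singleton)
    have "{y \<in> space ?Q. y t = k} \<in> sets ?Q" by measurable
    ultimately show ?thesis
      using t indep_families_prob[OF XN, of "{x \<in> space ?P. (\<Sum>i = 1..k. x i) = n}"
          "{y \<in> space ?Q. y t = k}"]
        prob_partial_sum[OF indep X0 Xj, where k = k and n = n]
      by (simp add: A_def space_PiM)
  qed
  have [measurable]: "A k \<in> events" for k
    unfolding A_def by measurable
  have "{\<omega> \<in> space M. (\<Sum>i = 1..N t \<omega>. X i \<omega>) = n} = (\<Union>k. A k)"
    by (auto simp: A_def)
  moreover have "(\<lambda>k. prob (A k)) sums prob (\<Union>k. A k)"
    by (rule finite_measure_UNION) (auto, auto simp: A_def disjoint_family_on_def)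
  \<comment> \<open>Events with \<open>k > n\<close> have probability 0, so the series over
    \<open>k\<close> is a finite sum.\<close>
  moreover have "(\<lambda>k. prob (A k)) sums (\<Sum>k\<le>n. prob (A k))"
    by (rule sums_finite) (auto simp: A iter_conv_eq_0)
  ultimately have "prob {\<omega> \<in> space M. (\<Sum>i = 1..N t \<omega>. X i \<omega>) = n} = (\<Sum>k\<le>n. prob (A k))"
    using sums_unique2 by metis
  then show ?thesis by (simp add: A)
qed

text \<open>The law of each \<open>X i\<close> is prescribed only on positive values; once those
  carry total mass 1, nothing remains for 0.\<close>

lemma prob_eq_0_of_total_mass:
  fixes Y :: "'a \<Rightarrow> nat"
  assumes [measurable]: "Y \<in> measurable M (count_space UNIV)"
    and "(\<lambda>j. prob {\<omega> \<in> space M. Y \<omega> = Suc j}) sums 1"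
  shows "prob {\<omega> \<in> space M. Y \<omega> = 0} = 0"
proof -
  have "(\<lambda>j. prob {\<omega> \<in> space M. Y \<omega> = j}) sums prob (\<Union>j. {\<omega> \<in> space M. Y \<omega> = j})"
    by (rule finite_measure_UNION) (auto simp: disjoint_family_on_def)
  also have "(\<Union>j. {\<omega> \<in> space M. Y \<omega> = j}) = space M" by auto
  finally have "(\<lambda>j. prob {\<omega> \<in> space M. Y \<omega> = j}) sums 1" by (simp add: prob_space)
  moreover have "(\<lambda>j. prob {\<omega> \<in> space M. Y \<omega> = j}) sums (1 + prob {\<omega> \<in> space M. Y \<omega> = 0})"
    using sums_Suc[OF assms(2)] .
  ultimately show ?thesis using sums_unique2 by fastforce
qed

end

section \<open>Intensities and their discrete convolutions\<close>

text \<open>The ratio condition makes the intensities summable. Their vanishing limit is what gives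
  the telescoping jump probabilities total mass 1.\<close>

lemma intensity_parameters_tendsto_0:
  assumes "intensity_parameters lam"
  shows "(\<lambda>j::nat. lam (int j)) \<longlonglongrightarrow> 0"
proof -
  have pos: "lam (int j) \<ge> 0" for j
    using assms by (cases "j = 0") (auto simp: intensity_parameters_def less_imp_le)
  have mono: "lam (int j + 1) \<le> lam (int j)" for j
    using assms by (auto simp: intensity_parameters_def)
  from assms consider
      (lim) L where "L < 1" "(\<lambda>j::nat. lam (int j + 1) / lam (int j)) \<longlonglongrightarrow> L"
    | (zero) "\<forall>\<^sub>F j::nat in sequentially. lam (int j) = 0"
    by (auto simp: intensity_parameters_def)
  then show ?thesis
  proof cases
    case lim
    obtain r where r: "L < r" "r < 1" using dense[OF lim(1)] by blast
    from order_tendstoD(2)[OF lim(2) r(1)] obtain n0 where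
      n0: "\<And>n. n \<ge> n0 \<Longrightarrow> lam (int n + 1) / lam (int n) < r"
      by (auto simp: eventually_sequentially)
    have "norm (lam (int (Suc n))) \<le> r * norm (lam (int n))" if "n \<ge> n0" for n
    proof (cases "lam (int n) = 0")
      \<comment> \<open>Here the quotient is 0 by the convention for division by zero and says
        nothing about the next intensity; monotonicity does.\<close>
      case True
      then show ?thesis using mono[of n] pos[of "Suc n"] by (simp add: add.commute)
    next
      case False
      then have "lam (int n) > 0" using pos[of n] by simp
      then show ?thesis
        using n0[OF that] pos[of "Suc n"] by (simp add: pos_divide_less_eq add.commute)
    qed
    then have "summable (\<lambda>j. lam (int j))"
      by (rule summable_ratio_test[OF r(2)])
    then show ?thesis by (rule summable_LIMSEQ_zero)
  next
    case zero
    then show ?thesis by (rule tendsto_eventually)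
  qed
qed

text \<open>The two supports leave only finitely many nonzero terms. The value at -1 is needed for
  the convolution at \<open>n - 1\<close> when \<open>n = 0\<close>.\<close>

lemma discrete_conv_eq_sum:
  assumes "\<And>j. j < 0 \<Longrightarrow> a j = 0" and "\<And>k. k < 0 \<Longrightarrow> b k = 0"
  shows "discrete_conv a b (int n) = (\<Sum>j\<le>n. a (int j) * b (int (n - j)))"
    and "discrete_conv a b (-1) = 0"
proof -
  have "discrete_conv a b (int n) = (\<Sum>\<^sub>\<infinity>j\<in>{0..int n}. a j * b (int n - j))"
    unfolding discrete_conv_def using assms
    by (intro infsum_cong_neutral) (auto simp: not_le)
  also have "\<dots> = (\<Sum>j\<in>{0..int n}. a j * b (int n - j))" by simp
  also have "\<dots> = (\<Sum>j\<le>n. a (int j) * b (int (n - j)))"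
    by (rule sum.reindex_bij_witness[of _ int nat]) (auto simp: of_nat_diff)
  finally show "discrete_conv a b (int n) = (\<Sum>j\<le>n. a (int j) * b (int (n - j)))" .
  have "(\<lambda>j. a j * b (- 1 - j)) = (\<lambda>_. 0)"
  proof
    fix j show "a j * b (- 1 - j) = 0" using assms by (cases "j < 0") auto
  qed
  then show "discrete_conv a b (-1) = 0" by (simp add: discrete_conv_def)
qed

text \<open>Shifting the index of the second convolution by one aligns it with the first. For the
  intensities, the resulting differences are \<open>lam 0\<close> times the jump
  probabilities.\<close>

lemma discrete_conv_diff:
  assumes "\<And>j. j < 0 \<Longrightarrow> a j = 0" and "\<And>k. k < 0 \<Longrightarrow> b k = 0"
  shows "- discrete_conv a b (int n) + discrete_conv a b (int n - 1)
    = - a 0 * b (int n) + (\<Sum>j = 1..n. (a (int j - 1) - a (int j)) * b (int (n - j)))"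
proof (cases n)
  case 0
  then show ?thesis using discrete_conv_eq_sum(1)[of a b 0, OF assms] discrete_conv_eq_sum(2)[of a b, OF assms] by simp
next
  case (Suc m)
  have "discrete_conv a b (int n - 1) = (\<Sum>j\<le>m. a (int j) * b (int (m - j)))"
    using discrete_conv_eq_sum(1)[of a b m, OF assms] Suc by simp
  also have "\<dots> = (\<Sum>j = 1..n. a (int j - 1) * b (int (n - j)))"
    unfolding Suc by (rule sum.reindex_bij_witness[of _ "\<lambda>j. j - 1" Suc]) (auto simp: of_nat_diff)
  finally have 1: "discrete_conv a b (int n - 1) = (\<Sum>j = 1..n. a (int j - 1) * b (int (n - j)))" .
  have "discrete_conv a b (int n) = a 0 * b (int n) + (\<Sum>j = 1..n. a (int j) * b (int (n - j)))"
    using discrete_conv_eq_sum(1)[of a b n, OF assms]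
    by (simp add: atLeast1_atMost_eq_remove0 sum.remove[of "{..n}" 0])
  with 1 show ?thesis by (simp add: left_diff_distrib sum_subtractf)
qed

section \<open>Identification of the two laws\<close>

theorem theorem3p2:
  fixes \<alpha> :: real and lam :: "int \<Rightarrow> real"
    and M :: "'a measure" and Nc :: "real \<Rightarrow> 'a \<Rightarrow> nat"
    and M' :: "'b measure" and N :: "real \<Rightarrow> 'b \<Rightarrow> nat" and X :: "nat \<Rightarrow> 'b \<Rightarrow> nat"
  assumes "0 < \<alpha>" and "\<alpha> \<le> 1"
    and "intensity_parameters lam"
    and "convoluted_fractional_poisson \<alpha> lam M Nc"
    and "time_fractional_poisson \<alpha> (lam 0) M' N"
    and "prob_space.indep_vars M' (\<lambda>_. count_space UNIV) X {1..}"
    and "\<And>i j. i \<ge> 1 \<Longrightarrow> j \<ge> 1 \<Longrightarrow>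
           measure M' {\<omega> \<in> space M'. X i \<omega> = j} = (lam (int j - 1) - lam (int j)) / lam 0"
    and "indep_families M' {1..} X {0..} N"
    and "t \<ge> 0"
  shows "distr M (count_space UNIV) (Nc t) =
         distr M' (count_space UNIV) (\<lambda>\<omega>. \<Sum>i = 1..N t \<omega>. X i \<omega>)"
proof -
  have Nc: "nat_process M Nc" and Nc0: "state_prob M Nc 0 0 = 1" "\<And>n. n \<ge> 1 \<Longrightarrow> state_prob M Nc n 0 = 0"
    and Nc_diff: "\<And>n. caputo_differentiable \<alpha> (state_prob M Nc (int n))"
    and Nc_eq: "\<And>n t. t > 0 \<Longrightarrow> caputo_deriv \<alpha> (state_prob M Nc (int n)) t =
           - discrete_conv lam (\<lambda>k. state_prob M Nc k t) (int n)
           + discrete_conv lam (\<lambda>k. state_prob M Nc k t) (int n - 1)"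
    using assms(4) by (auto simp: convoluted_fractional_poisson_def)
  have N: "nat_process M' N" and N0: "state_prob M' N 0 0 = 1" "\<And>n. n \<ge> 1 \<Longrightarrow> state_prob M' N n 0 = 0"
    and N_diff: "\<And>n. caputo_differentiable \<alpha> (state_prob M' N (int n))"
    and N_eq: "\<And>n t. t > 0 \<Longrightarrow> caputo_deriv \<alpha> (state_prob M' N (int n)) t =
           - lam 0 * state_prob M' N (int n) t + lam 0 * state_prob M' N (int n - 1) t"
    using assms(5) by (auto simp: time_fractional_poisson_def)
  interpret M: prob_space M using Nc by (simp add: nat_process_def)
  interpret M': prob_space M' using N by (simp add: nat_process_def)
  have [measurable]: "Nc t \<in> measurable M (count_space UNIV)" "N t \<in> measurable M' (count_space UNIV)"
    using Nc N \<open>t \<ge> 0\<close> by (auto simp: nat_process_def)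
  have X: "X i \<in> measurable M' (count_space UNIV)" if "i \<in> {1..}" for i
    using assms(6) that by (auto simp: M'.indep_vars_def)
  have lam0: "lam 0 > 0" and lam_neg: "\<And>j. j < 0 \<Longrightarrow> lam j = 0"
    using assms(3) by (auto simp: intensity_parameters_def)

  \<comment> \<open>At \<open>j = 0\<close> this formula gives -1, which is no probability; all sums
    using \<open>a\<close> start at 1.\<close>
  define a where "a j = (lam (int j - 1) - lam (int j)) / lam 0" for j :: nat
  have Xj: "M'.prob {\<omega> \<in> space M'. X i \<omega> = j} = a j" if "i \<ge> 1" "j \<ge> 1" for i j
    using assms(7)[OF that] by (simp add: a_def)
  have "(\<lambda>j. (lam (int j) - lam (int (Suc j))) / lam 0) sums ((lam (int 0) - 0) / lam 0)"
    by (intro sums_divide telescope_sums' intensity_parameters_tendsto_0 assms(3))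
  then have "(\<lambda>j. a (Suc j)) sums 1" using lam0 by (simp add: a_def)
  then have X0: "M'.prob {\<omega> \<in> space M'. X i \<omega> = 0} = 0" if "i \<ge> 1" for i
    using that by (intro M'.prob_eq_0_of_total_mass X) (auto simp: Xj)

  define P where "P n = state_prob M Nc (int n)" for n
  \<comment> \<open>\<open>P\<close> is the law of the convoluted process, \<open>p\<close> that of
    the number of jumps, and \<open>q\<close> below is the law of the random sum in the form given
    by \<open>prob_random_sum\<close>.\<close>
  define p where "p n = state_prob M' N (int n)" for n
  define q where "q n s = (\<Sum>k\<le>n. iter_conv a k n * p k s)" for n s
  have P_eq: "caputo_deriv \<alpha> (P n) s = - lam 0 * P n s + lam 0 * (\<Sum>j = 1..n. a j * P (n - j) s)"
    if "s > 0" for n s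
    using Nc_eq[OF that, of n] lam0
    by (subst (asm) discrete_conv_diff)
      (auto simp: lam_neg state_prob_neg P_def a_def sum_distrib_left)
  have p_eq: "caputo_deriv \<alpha> (p k) s = - lam 0 * p k s + lam 0 * (if k = 0 then 0 else p (k - 1) s)"
    if "s > 0" for k s
    using N_eq[OF that, of k] by (cases k) (auto simp: p_def state_prob_neg)
  have p_diff: "caputo_differentiable \<alpha> (p k)" for k
    using N_diff by (simp add: p_def)
  have q_diff: "caputo_differentiable \<alpha> (q n)" for n
    unfolding q_def
    by (intro caputo_sum(1) caputo_differentiable_cmult p_diff \<open>\<alpha> \<le> 1\<close>) simp
  have q_eq: "caputo_deriv \<alpha> (q n) s = - lam 0 * q n s + lam 0 * (\<Sum>j = 1..n. a j * q (n - j) s)"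
    if "s > 0" for n s
  proof -
    have "caputo_deriv \<alpha> (q n) s = (\<Sum>k\<le>n. iter_conv a k n * caputo_deriv \<alpha> (p k) s)"
      unfolding q_def using that
      by (subst caputo_sum(2))
        (simp_all add: caputo_differentiable_cmult caputo_deriv_cmult p_diff \<open>\<alpha> \<le> 1\<close>)
    also have "\<dots> = - lam 0 * q n s
        + lam 0 * (\<Sum>k\<le>n. iter_conv a k n * (if k = 0 then 0 else p (k - 1) s))"
      unfolding p_eq[OF that] q_def sum_distrib_left sum.distrib[symmetric]
      by (intro sum.cong refl) (simp add: algebra_simps)
    finally show ?thesis
      by (simp only: sum_iter_conv_shift[where p = "\<lambda>k. p k s"] q_def)
  qed
  have q0: "q n 0 = P n 0" for n
  proof -
    \<comment> \<open>At time 0 the number of jumps is almost surely 0, so only \<open>k = 0\<close>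
      contributes.\<close>
    have "q n 0 = (\<Sum>k\<in>{0}. iter_conv a k n * p k 0)"
      unfolding q_def by (rule sum.mono_neutral_right) (auto simp: p_def N0)
    then show ?thesis by (cases "n = 0") (simp_all add: p_def P_def N0 Nc0)
  qed

  have Pq: "P n s = q n s" if "s \<ge> 0" for n s
    using that
  \<comment> \<open>The time is generalised because the relaxation equation for level
    \<open>n\<close> must hold at every \<open>u > 0\<close>, which uses the lower levels at all
    those times.\<close>
  proof (induction n arbitrary: s rule: less_induct)
    case (less n)
    let ?f = "\<lambda>s. P n s + - 1 * q n s"
    have P_diff: "caputo_differentiable \<alpha> (P n)" using Nc_diff by (simp add: P_def)
    have "?f s = 0"
    proof (rule caputo_relaxation_zero[OF _ assms(1,2) lam0 _ _ \<open>s \<ge> 0\<close>])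
      show "caputo_differentiable \<alpha> ?f"
        by (intro caputo_differentiable_add caputo_differentiable_cmult P_diff q_diff)
      show "?f 0 = 0" by (simp add: q0)
      fix u :: real assume "u > 0"
      have "(\<Sum>j = 1..n. a j * P (n - j) u) = (\<Sum>j = 1..n. a j * q (n - j) u)"
        using \<open>u > 0\<close> by (intro sum.cong refl) (simp add: less.IH)
      moreover have "caputo_deriv \<alpha> ?f u = caputo_deriv \<alpha> (P n) u + - 1 * caputo_deriv \<alpha> (q n) u"
        using \<open>u > 0\<close> \<open>\<alpha> \<le> 1\<close>
        by (subst caputo_deriv_add)
          (simp_all only: P_diff q_diff caputo_differentiable_cmult caputo_deriv_cmult)
      ultimately show "caputo_deriv \<alpha> ?f u = - lam 0 * ?f u"
        by (simp add: P_eq q_eq \<open>u > 0\<close> algebra_simps)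
    qed
    then show ?case by simp
  qed

  have meas: "(\<lambda>\<omega>. \<Sum>i = 1..N t \<omega>. X i \<omega>) \<in> measurable M' (count_space UNIV)"
    by (rule measurable_compose_countable[where f = "\<lambda>k \<omega>. \<Sum>i = 1..k. X i \<omega>"])
      (auto intro!: measurable_sum_nat X)
  show ?thesis
  proof (rule measure_eqI_countable[where A = UNIV])
    fix n :: nat
    have "M.prob {\<omega> \<in> space M. Nc t \<omega> = n} = M'.prob {\<omega> \<in> space M'. (\<Sum>i = 1..N t \<omega>. X i \<omega>) = n}"
      using Pq[OF \<open>t \<ge> 0\<close>, of n] \<open>t \<ge> 0\<close> M'.prob_random_sum[OF assms(6) X0 Xj assms(8), of t n]
      by (simp add: P_def q_def p_def state_prob_def)
    moreover have "Nc t -` {n} \<inter> space M = {\<omega> \<in> space M. Nc t \<omega> = n}"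
      and "(\<lambda>\<omega>. \<Sum>i = 1..N t \<omega>. X i \<omega>) -` {n} \<inter> space M' = {\<omega> \<in> space M'. (\<Sum>i = 1..N t \<omega>. X i \<omega>) = n}"
      by auto
    ultimately show "emeasure (distr M (count_space UNIV) (Nc t)) {n}
      = emeasure (distr M' (count_space UNIV) (\<lambda>\<omega>. \<Sum>i = 1..N t \<omega>. X i \<omega>)) {n}"
      by (simp add: emeasure_distr meas M.emeasure_eq_measure M'.emeasure_eq_measure del: One_nat_def)
  qed simp_all
qed

end
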